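(* Let $x^0\in L^2(I,\mathbb{R}^d)$ and let $a:\mathbb{R}_+\times I\times I\to[0,1]$ be Lebesgue measurable. Assume that for almost every $t\geq 0$ the kernel $a(t)$ is balanced, i.e. $\int_I a(t,i,j)\,\mathrm{d}j=\int_I a(t,j,i)\,\mathrm{d}j$ for almost every $i\in I$. Suppose that there exist $\tau>0$ and $\mu\in(0,1]$ such that $$\frac1\tau\int_t^{t+\tau}\lambda_2(\mathbb{L}(s))\,\mathrm{d}s\geq\mu\qquad\text{for all } t\geq 0 .$$ Let $x(\cdot)\in\mathrm{Lip}_{\mathrm{loc}}(\mathbb{R}_+,L^2(I,\mathbb{R}^d))$ be the solution of the linear dynamics $\dot x(t)=-\mathbb{L}(t)x(t)$, $x(0)=x^0$, that is $$\partial_t x(t,i)=\int_I a(t,i,j)(x(t,j)-x(t,i))\,\mathrm{d}j,\qquad x(0)=x^0 .$$ Then there exists a constant $\alpha>0$ depending only on $(\tau,\mu)$ such that $$\|x(t)-\bar{x}^0\|_{L^2(I,\mathbb{R}^d)}\leq\alpha\,\|x(0)-\bar{x}^0\|_{L^2(I,\mathbb{R}^d)}\exp(-\mu t)\qquad\text{for all } t\geq 0 .$$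
   Context: $I:=[0,1]$ with the Lebesgue measure, $d\geq 1$ is an integer, $\mathbb{R}_+=[0,+\infty)$. The dynamics is understood for almost every $t\geq 0$ and almost every $i\in I$. $\bar{x}^0:=\int_I x^0(i)\,\mathrm{d}i\in\mathbb{R}^d$, identified with a constant function on $I$. For almost every $t\geq 0$, the graph-Laplacian $\mathbb{L}(t)$ is the bounded linear operator on $L^2(I,\mathbb{R}^d)$ given by $(\mathbb{L}(t)y)(i):=\int_I a(t,i,j)(y(i)-y(j))\,\mathrm{d}j$. Let $\mathscr{C}\subset L^2(I,\mathbb{R}^d)$ be the subspace of constant functions, so that $\mathscr{C}^\perp=\{x\in L^2(I,\mathbb{R}^d):\int_I x(i)\,\mathrm{d}i=0\}$. For a bounded linear operator $T$ on $L^2(I,\mathbb{R}^d)$, $$\lambda_2(T):=\inf_{x\in\mathscr{C}^\perp\setminus\{0\}}\frac{\langle Tx,x\rangle_{L^2(I,\mathbb{R}^d)}}{\|x\|^2_{L^2(I,\mathbb{R}^d)}} .$$ *)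

theory Defs
  imports "HOL-Analysis.Analysis"
begin

text \<open>
  The dimension \<^term>\<open>d\<close> is a natural number and not a type, because the constant of the
  theorem has to be chosen independently of it.  A vector of R^d is a function
  \<^typ>\<open>nat \<Rightarrow> real\<close> of which only the coordinates \<open>k < d\<close> are relevant, and the integral of
  a vector-valued function is taken coordinatewise.  Elements of L^2(I, R^d) are represented by
  functions \<^typ>\<open>real \<Rightarrow> nat \<Rightarrow> real\<close>; equality in L^2 is equality of the coordinates
  \<open>k < d\<close> almost everywhere on I.
\<close>

abbreviation unit_int :: "real measure"
  where "unit_int \<equiv> lebesgue_on {0..1}"

definition L2 :: "nat \<Rightarrow> (real \<Rightarrow> nat \<Rightarrow> real) set"
  where "L2 d = {f. \<forall>k<d. (\<lambda>i. f i k) \<in> borel_measurable unit_int \<and>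
                          integrable unit_int (\<lambda>i. (f i k)\<^sup>2)}"

definition eq_L2 :: "nat \<Rightarrow> (real \<Rightarrow> nat \<Rightarrow> real) \<Rightarrow> (real \<Rightarrow> nat \<Rightarrow> real) \<Rightarrow> bool"
  where "eq_L2 d f g \<longleftrightarrow> (AE i in unit_int. \<forall>k<d. f i k = g i k)"

definition inner_L2 :: "nat \<Rightarrow> (real \<Rightarrow> nat \<Rightarrow> real) \<Rightarrow> (real \<Rightarrow> nat \<Rightarrow> real) \<Rightarrow> real"
  where "inner_L2 d f g = (LINT i|unit_int. (\<Sum>k<d. f i k * g i k))"

definition norm_L2 :: "nat \<Rightarrow> (real \<Rightarrow> nat \<Rightarrow> real) \<Rightarrow> real"
  where "norm_L2 d f = sqrt (inner_L2 d f f)"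

definition mean :: "(real \<Rightarrow> nat \<Rightarrow> real) \<Rightarrow> nat \<Rightarrow> real"
  where "mean f k = (LINT i|unit_int. f i k)"

definition constants :: "nat \<Rightarrow> (real \<Rightarrow> nat \<Rightarrow> real) set"
  where "constants d = {f \<in> L2 d. \<exists>c. eq_L2 d f (\<lambda>_. c)}"

definition constants_perp :: "nat \<Rightarrow> (real \<Rightarrow> nat \<Rightarrow> real) set"
  where "constants_perp d = {f \<in> L2 d. \<forall>g \<in> constants d. inner_L2 d f g = 0}"

definition lambda2 ::
  "nat \<Rightarrow> ((real \<Rightarrow> nat \<Rightarrow> real) \<Rightarrow> (real \<Rightarrow> nat \<Rightarrow> real)) \<Rightarrow> real"
  where "lambda2 d T =
    (INF f \<in> {f \<in> constants_perp d. \<not> eq_L2 d f (\<lambda>_ _. 0)}.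
       inner_L2 d (T f) f / (norm_L2 d f)\<^sup>2)"

definition graph_laplacian ::
  "(real \<Rightarrow> real \<Rightarrow> real \<Rightarrow> real) \<Rightarrow> real \<Rightarrow> (real \<Rightarrow> nat \<Rightarrow> real) \<Rightarrow> (real \<Rightarrow> nat \<Rightarrow> real)"
  where "graph_laplacian a t y = (\<lambda>i k. LINT j|unit_int. a t i j * (y i k - y j k))"

definition balanced :: "(real \<Rightarrow> real \<Rightarrow> real) \<Rightarrow> bool"
  where "balanced b \<longleftrightarrow>
    (AE i in unit_int. (LINT j|unit_int. b i j) = (LINT j|unit_int. b j i))"

definition Lip_loc_L2 :: "nat \<Rightarrow> (real \<Rightarrow> real \<Rightarrow> nat \<Rightarrow> real) \<Rightarrow> bool"
  where "Lip_loc_L2 d x \<longleftrightarrow>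
    (\<forall>t\<ge>0. x t \<in> L2 d) \<and>
    (\<forall>t\<ge>0. \<exists>\<epsilon>>0. \<exists>K. \<forall>r \<in> {0..} \<inter> ball t \<epsilon>. \<forall>s \<in> {0..} \<inter> ball t \<epsilon>.
       norm_L2 d (\<lambda>i k. x s i k - x r i k) \<le> K * \<bar>s - r\<bar>)"

text \<open>
  Derivative in the norm of L^2 of a curve defined on the nonnegative half-line.  Membership of
  \<open>v\<close> in L^2 is required explicitly, because \<^const>\<open>norm_L2\<close> is meaningless on functions that
  are not square integrable.
\<close>

definition has_L2_derivative ::
  "nat \<Rightarrow> (real \<Rightarrow> real \<Rightarrow> nat \<Rightarrow> real) \<Rightarrow> (real \<Rightarrow> nat \<Rightarrow> real) \<Rightarrow> real \<Rightarrow> bool"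
  where "has_L2_derivative d x v t \<longleftrightarrow> v \<in> L2 d \<and>
    ((\<lambda>s. norm_L2 d (\<lambda>i k. (x s i k - x t i k) / (s - t) - v i k)) \<longlongrightarrow> 0) (at t within {0..})"

definition is_solution ::
  "nat \<Rightarrow> (real \<Rightarrow> real \<Rightarrow> real \<Rightarrow> real) \<Rightarrow> (real \<Rightarrow> nat \<Rightarrow> real) \<Rightarrow>
   (real \<Rightarrow> real \<Rightarrow> nat \<Rightarrow> real) \<Rightarrow> bool"
  where "is_solution d a x0 x \<longleftrightarrow>
    Lip_loc_L2 d x \<and> eq_L2 d (x 0) x0 \<and>
    (AE t in lebesgue_on {0..}.
       has_L2_derivative d x (\<lambda>i k. - graph_laplacian a t (x t) i k) t)"

lemma integrable_L2_coord:
  assumes "f \<in> L2 d" "k < d"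
  shows "integrable unit_int (\<lambda>i. f i k)"
proof -
  interpret finite_measure unit_int
    by (rule finite_measure_lebesgue_on) simp
  show ?thesis
    by (rule square_integrable_imp_integrable[of "\<lambda>i. f i k"]) (use assms in \<open>simp_all add: L2_def\<close>)
qed

lemma constants_perp_eq: "constants_perp d = {f \<in> L2 d. \<forall>k<d. mean f k = 0}"
proof -
  have const: "(\<lambda>_. c) \<in> constants d" for c
  proof -
    interpret finite_measure unit_int
      by (rule finite_measure_lebesgue_on) simp
    have "(\<lambda>_. c) \<in> L2 d" by (simp add: L2_def)
    moreover have "eq_L2 d (\<lambda>_. c) (\<lambda>_. c)" by (simp add: eq_L2_def)
    ultimately show ?thesis unfolding constants_def by blast
  qed
  have inner: "inner_L2 d f g = (\<Sum>k<d. mean f k * c k)"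
    if f: "f \<in> L2 d" and g: "g \<in> L2 d" and eq: "eq_L2 d g (\<lambda>_. c)" for f g c
  proof -
    have "inner_L2 d f g = (LINT i|unit_int. (\<Sum>k<d. f i k * c k))"
      unfolding inner_L2_def
    proof (rule integral_cong_AE)
      show "AE i in unit_int. (\<Sum>k<d. f i k * g i k) = (\<Sum>k<d. f i k * c k)"
        using eq unfolding eq_L2_def by (rule eventually_mono) simp
    qed (use f g in \<open>auto simp: L2_def intro!: borel_measurable_sum borel_measurable_times\<close>)
    also have "\<dots> = (\<Sum>k<d. mean f k * c k)"
      unfolding mean_def
      by (subst Bochner_Integration.integral_sum)
        (simp_all add: integrable_L2_coord[OF f])
    finally show ?thesis .
  qed
  show ?thesis
  proof (intro equalityI subsetI)
    fix f assume f: "f \<in> constants_perp d"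
    then have L: "f \<in> L2 d" and orth: "\<forall>g\<in>constants d. inner_L2 d f g = 0"
      by (simp_all add: constants_perp_def)
    have "mean f k = 0" if "k < d" for k
    proof -
      let ?c = "\<lambda>l::nat. if l = k then 1 else 0::real"
      have "0 = inner_L2 d f (\<lambda>_. ?c)" using bspec[OF orth const[of ?c]] by simp
      also have "\<dots> = (\<Sum>l<d. mean f l * ?c l)"
        by (rule inner[OF L]) (use const[of ?c] in \<open>simp add: constants_def\<close>, simp add: eq_L2_def)
      also have "\<dots> = mean f k" using that by (simp add: if_distrib cong: if_cong)
      finally show ?thesis by simp
    qed
    then show "f \<in> {f \<in> L2 d. \<forall>k<d. mean f k = 0}" using L by simp
  next
    fix f assume "f \<in> {f \<in> L2 d. \<forall>k<d. mean f k = 0}"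
    then have L: "f \<in> L2 d" and m: "\<forall>k<d. mean f k = 0" by simp_all
    have "inner_L2 d f g = 0" if g: "g \<in> constants d" for g
    proof -
      from g obtain c where "g \<in> L2 d" "eq_L2 d g (\<lambda>_. c)"
        unfolding constants_def by blast
      then have "inner_L2 d f g = (\<Sum>k<d. mean f k * c k)" by (rule inner[OF L])
      then show ?thesis using m by simp
    qed
    then show "f \<in> constants_perp d" using L by (simp add: constants_perp_def)
  qed
qed

end

theory Submission
  imports Defs
begin

text \<open>
  Put E(t) for the squared distance of x(t) to the mean of the initial datum.  Balancedness makes
  the mean of x(t) constant and the quadratic form of the graph-Laplacian nonnegative, so almost
  everywhere \<open>E' \<le> - 2 \<lambda>\<^sub>2 E\<close> and \<open>E' \<le> 0\<close>.  The functions E and, as long as E is positive,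
  ln E are Lipschitz on compact intervals, and a Lipschitz function increases by at most the
  integral of any almost everywhere upper bound of its derivative.  Hence E is nonincreasing and
  is multiplied by at most \<open>exp (- 2 \<mu> \<tau>)\<close> over every interval of length \<open>\<tau>\<close>; the incomplete last
  interval costs the factor \<open>\<alpha> = exp (\<mu> \<tau>)\<close>.
\<close>

subsection \<open>Lipschitz functions with an almost everywhere bounded derivative\<close>

text \<open>A tagged division that is fine for a suitable gauge compares the telescoping sum of the
  increments of \<open>f\<close> with a Riemann sum of \<open>g\<close>. Pieces tagged outside
  \<open>N\<close> are controlled by the derivative at the tag, pieces tagged in \<open>N\<close> by
  the Lipschitz constant.\<close>

lemma lipschitz_diff_le_integral:
  fixes f g :: "real \<Rightarrow> real"
  assumes ab: "a \<le> b" and lip: "L-lipschitz_on {a..b} f" and N: "negligible N"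
    and g: "g integrable_on {a..b}"
    and deriv: "\<And>t. t \<in> {a..b} - N \<Longrightarrow> \<exists>D\<le>g t. (f has_real_derivative D) (at t within {a..b})"
  shows "f b - f a \<le> integral {a..b} g"
proof (rule field_le_epsilon)
  fix \<epsilon> :: real assume "\<epsilon> > 0"
  \<comment> \<open>One \<open>e\<close> is lost in the Riemann sum and \<open>e * (b - a)\<close>
    in the derivative estimates; this choice makes the total equal to \<epsilon>.\<close>
  define e where "e = \<epsilon> / (1 + (b - a))"
  have e: "e > 0" "e + e * (b - a) = \<epsilon>"
  proof -
    have "1 + (b - a) > 0" using ab by simp
    then have "e > 0" "e * (1 + (b - a)) = \<epsilon>"
      using \<open>\<epsilon> > 0\<close> unfolding e_def by (simp, metis less_irrefl nonzero_eq_divide_eq)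
    then show "e > 0" "e + e * (b - a) = \<epsilon>" by (simp_all add: distrib_left)
  qed
  \<comment> \<open>Changing \<open>g\<close> to the Lipschitz constant on the null set makes the pieces tagged there harmless.\<close>
  define h where "h t = (if t \<in> N then L else g t)" for t
  have "(h has_integral integral {a..b} g) {a..b}"
    by (rule has_integral_spike[OF N _ integrable_integral[OF g]]) (simp add: h_def)
  then obtain \<gamma> where \<gamma>: "gauge \<gamma>"
    and \<gamma>_fine: "\<And>p. p tagged_division_of {a..b} \<Longrightarrow> \<gamma> fine p \<Longrightarrow>
      norm ((\<Sum>(x,k)\<in>p. measure lborel k *\<^sub>R h x) - integral {a..b} g) < e"
    unfolding has_integral_real using e by meson
  \<comment> \<open>The factor \<open>sgn (y - t)\<close> states at once the bound on
    \<open>f y - f t\<close> to the right of \<open>t\<close> and the bound on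
    \<open>f t - f y\<close> to its left.\<close>
  have "\<exists>\<delta>>0. \<forall>y\<in>{a..b}. \<bar>y - t\<bar> < \<delta> \<longrightarrow> 
     (f y - f t) * sgn (y - t) \<le> (h t + e) * \<bar>y - t\<bar>" if t: "t \<in> {a..b} - N" for t
  proof -
    obtain D where D: "D \<le> g t" "(f has_real_derivative D) (at t within {a..b})"
      using deriv[OF t] by blast
    then obtain \<delta> where \<delta>: "\<delta> > 0"
      "\<And>y. y \<in> {a..b} \<Longrightarrow> \<bar>y - t\<bar> < \<delta> \<Longrightarrow> \<bar>f y - f t - D * (y - t)\<bar> \<le> e * \<bar>y - t\<bar>"
      unfolding has_field_derivative_def has_derivative_within_alt using e by (metis real_norm_def)
    have "(f y - f t) * sgn (y - t) \<le> (h t + e) * \<bar>y - t\<bar>"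
      if y: "y \<in> {a..b}" "\<bar>y - t\<bar> < \<delta>" for y
    proof -
      have "(f y - f t) * sgn (y - t) = (f y - f t - D * (y - t)) * sgn (y - t) + D * \<bar>y - t\<bar>"
        by (simp add: algebra_simps abs_sgn)
      also have "(f y - f t - D * (y - t)) * sgn (y - t) \<le> \<bar>f y - f t - D * (y - t)\<bar>"
        by (auto simp: sgn_if)
      also have "\<dots> \<le> e * \<bar>y - t\<bar>" using \<delta>(2)[OF y] .
      also have "D * \<bar>y - t\<bar> \<le> h t * \<bar>y - t\<bar>"
        using t D by (intro mult_right_mono) (auto simp: h_def)
      finally show ?thesis by (simp add: algebra_simps)
    qed
    with \<delta>(1) show ?thesis by blast
  qed
  then obtain \<delta> where \<delta>: "\<And>t. t \<in> {a..b} - N \<Longrightarrow> \<delta> t > 0"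
    "\<And>t y. t \<in> {a..b} - N \<Longrightarrow> y \<in> {a..b} \<Longrightarrow> \<bar>y - t\<bar> < \<delta> t \<Longrightarrow>
       (f y - f t) * sgn (y - t) \<le> (h t + e) * \<bar>y - t\<bar>"
    by metis
  \<comment> \<open>Tags in \<open>N\<close> carry no restriction, since the Lipschitz bound holds
    on pieces of every length.\<close>
  define \<gamma>' where "\<gamma>' t = (if t \<in> {a..b} - N then ball t (\<delta> t) else UNIV)" for t
  have "gauge \<gamma>'" using \<delta>(1) by (auto simp: gauge_def \<gamma>'_def)
  then have "gauge (\<lambda>t. \<gamma> t \<inter> \<gamma>' t)" using \<gamma> by (rule gauge_Int[rotated])
  then obtain p where p: "p tagged_division_of {a..b}" and fine: "(\<lambda>t. \<gamma> t \<inter> \<gamma>' t) fine p"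
    by (rule fine_division_exists_real)
  have piece: "f (Sup k) - f (Inf k) \<le> measure lborel k *\<^sub>R (h x + e)" if xk: "(x, k) \<in> p" for x k
  proof -
    obtain u v where k: "k = cbox u v" using tagged_division_ofD(4)[OF p xk] by blast
    have x: "x \<in> k" and sub: "k \<subseteq> {a..b}" using tagged_division_ofD(2,3)[OF p xk] by auto
    have uv: "u \<le> x" "x \<le> v" using x k by auto
    have mem: "u \<in> {a..b}" "v \<in> {a..b}" "x \<in> {a..b}" using sub k uv x by auto
    have Sup: "Sup k = v" "Inf k = u" "measure lborel k = v - u" using k uv by auto
    have "f v - f u \<le> (h x + e) * (v - u)"
    proof (cases "x \<in> N")
      case True
      have "f v - f u \<le> L * (v - u)"
        using lipschitz_onD[OF lip mem(2,1)] uv by (simp add: dist_real_def)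
      also have "\<dots> \<le> (h x + e) * (v - u)"
        using True e uv by (intro mult_right_mono) (auto simp: h_def)
      finally show ?thesis .
    next
      case False
      then have "k \<subseteq> ball x (\<delta> x)"
        using fine xk mem(3) unfolding fine_def \<gamma>'_def by fastforce
      then have near: "\<bar>u - x\<bar> < \<delta> x" "\<bar>v - x\<bar> < \<delta> x"
        using uv subsetD[of k "ball x (\<delta> x)" u] subsetD[of k "ball x (\<delta> x)" v] k
        by (auto simp: dist_real_def)
      \<comment> \<open>The tag cuts the piece \<open>[u, v]\<close> in two, and the two increments
        add up with the common slope \<open>h x + e\<close>.\<close>
      have "f v - f x \<le> (h x + e) * (v - x)"
        using \<delta>(2)[of x v] False mem near uv by (cases "v = x") (auto simp: sgn_if)
      moreover have "f x - f u \<le> (h x + e) * (x - u)"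
        using \<delta>(2)[of x u] False mem near uv by (cases "u = x") (auto simp: sgn_if)
      ultimately show ?thesis by (simp add: algebra_simps)
    qed
    then show ?thesis using Sup by (simp add: mult.commute)
  qed
  have "f b - f a = (\<Sum>(x,k)\<in>p. f (Sup k) - f (Inf k))"
    by (rule additive_tagged_division_1[OF ab p, symmetric])
  also have "\<dots> \<le> (\<Sum>(x,k)\<in>p. measure lborel k *\<^sub>R (h x + e))"
    using piece by (intro sum_mono) auto
  also have "\<dots> = (\<Sum>(x,k)\<in>p. measure lborel k *\<^sub>R h x) + e * (\<Sum>(x,k)\<in>p. measure lborel k)"
    by (simp add: sum.distrib[symmetric] sum_distrib_left algebra_simps case_prod_unfold)
  also have "(\<Sum>(x,k)\<in>p. measure lborel k) = b - a"
    using additive_content_tagged_division[of p a b] p ab by simp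
  also have "(\<Sum>(x,k)\<in>p. measure lborel k *\<^sub>R h x) \<le> integral {a..b} g + e"
    using \<gamma>_fine[OF p] fine by (force simp: fine_def)
  finally show "f b - f a \<le> integral {a..b} g + \<epsilon>" using e(2) by linarith
qed

subsection \<open>The inner product of L2\<close>

lemma L2I:
  assumes "\<And>k. k < d \<Longrightarrow> (\<lambda>i. f i k) \<in> borel_measurable unit_int"
    "\<And>k. k < d \<Longrightarrow> integrable unit_int (\<lambda>i. (f i k)\<^sup>2)"
  shows "f \<in> L2 d"
  using assms by (simp add: L2_def)

lemma L2D:
  assumes "f \<in> L2 d" "k < d"
  shows "(\<lambda>i. f i k) \<in> borel_measurable unit_int" "integrable unit_int (\<lambda>i. (f i k)\<^sup>2)"
  using assms by (simp_all add: L2_def)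

lemma L2_integrable_mult:
  assumes f: "f \<in> L2 d" and g: "g \<in> L2 d" and k: "k < d"
  shows "integrable unit_int (\<lambda>i. f i k * g i k)"
proof (rule Bochner_Integration.integrable_bound)
  show "integrable unit_int (\<lambda>i. (f i k)\<^sup>2 + (g i k)\<^sup>2)"
    using L2D(2)[OF f k] L2D(2)[OF g k] by simp
  show "(\<lambda>i. f i k * g i k) \<in> borel_measurable unit_int"
    using L2D(1)[OF f k] L2D(1)[OF g k] by simp
  have "\<bar>x * y\<bar> \<le> x\<^sup>2 + y\<^sup>2" for x y :: real
  proof -
    have "2 * (\<bar>x\<bar> * \<bar>y\<bar>) \<le> x\<^sup>2 + y\<^sup>2"
      using sum_squares_bound[of "\<bar>x\<bar>" "\<bar>y\<bar>"] by (simp add: mult.assoc)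
    moreover have "0 \<le> \<bar>x\<bar> * \<bar>y\<bar>" by simp
    ultimately show ?thesis by (simp only: abs_mult)
  qed
  then show "AE i in unit_int. norm (f i k * g i k) \<le> norm ((f i k)\<^sup>2 + (g i k)\<^sup>2)"
    by (simp add: abs_mult)
qed

lemma L2_const: "(\<lambda>i. c) \<in> L2 d"
proof -
  interpret finite_measure unit_int by (rule finite_measure_lebesgue_on) simp
  show ?thesis by (simp add: L2_def)
qed

lemma L2_add_scale:
  assumes f: "f \<in> L2 d" and g: "g \<in> L2 d"
  shows "(\<lambda>i k. f i k + c * g i k) \<in> L2 d"
proof (rule L2I)
  fix k assume k: "k < d"
  show "(\<lambda>i. f i k + c * g i k) \<in> borel_measurable unit_int"
    using L2D(1)[OF f k] L2D(1)[OF g k] by simp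
  have "integrable unit_int (\<lambda>i. (f i k)\<^sup>2 + c\<^sup>2 * (g i k)\<^sup>2 + 2 * c * (f i k * g i k))"
    using L2D(2)[OF f k] L2D(2)[OF g k] L2_integrable_mult[OF f g k] by simp
  then show "integrable unit_int (\<lambda>i. (f i k + c * g i k)\<^sup>2)"
    by (simp add: power2_eq_square algebra_simps)
qed

lemma L2_diff:
  assumes "f \<in> L2 d" "g \<in> L2 d"
  shows "(\<lambda>i k. f i k - g i k) \<in> L2 d"
  using L2_add_scale[OF assms, of "-1"] by simp

lemma inner_L2_commute: "inner_L2 d f g = inner_L2 d g f"
  by (simp add: inner_L2_def mult.commute)

lemma inner_L2_eq_sum:
  assumes "f \<in> L2 d" "g \<in> L2 d"
  shows "inner_L2 d f g = (\<Sum>k<d. LINT i|unit_int. f i k * g i k)"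
  unfolding inner_L2_def
  by (rule Bochner_Integration.integral_sum) (simp add: L2_integrable_mult[OF assms])

lemma inner_L2_add_scale:
  assumes f: "f \<in> L2 d" and g: "g \<in> L2 d" and h: "h \<in> L2 d"
  shows "inner_L2 d (\<lambda>i k. f i k + c * g i k) h = inner_L2 d f h + c * inner_L2 d g h"
proof -
  have "(LINT i|unit_int. (f i k + c * g i k) * h i k) =
      (LINT i|unit_int. f i k * h i k) + c * (LINT i|unit_int. g i k * h i k)" if "k < d" for k
    using L2_integrable_mult[OF f h that] L2_integrable_mult[OF g h that]
    by (simp add: algebra_simps)
  then show ?thesis
    using L2_add_scale[OF f g] by (simp add: inner_L2_eq_sum assms sum.distrib sum_distrib_left)
qed

lemma inner_L2_self_nonneg: "inner_L2 d f f \<ge> 0"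
  unfolding inner_L2_def by (intro integral_nonneg_AE) (simp add: sum_nonneg)

lemma norm_L2_nonneg: "norm_L2 d f \<ge> 0"
  by (simp add: norm_L2_def inner_L2_self_nonneg)

lemma norm_L2_power2: "(norm_L2 d f)\<^sup>2 = inner_L2 d f f"
  by (simp add: norm_L2_def inner_L2_self_nonneg)

text \<open>The squared norm is a quadratic polynomial in \<open>c\<close>. Its nonnegativity yields
  Cauchy-Schwarz, \<open>c = 1\<close> the triangle inequality, and \<open>c = s - t\<close> the
  derivative of the squared norm along a curve.\<close>

lemma norm_L2_add_scale_power2:
  assumes f: "f \<in> L2 d" and g: "g \<in> L2 d"
  shows "(norm_L2 d (\<lambda>i k. f i k + c * g i k))\<^sup>2 =
    (norm_L2 d f)\<^sup>2 + 2 * c * inner_L2 d g f + c\<^sup>2 * (norm_L2 d g)\<^sup>2"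
proof -
  let ?h = "\<lambda>i k. f i k + c * g i k"
  have "inner_L2 d ?h ?h = inner_L2 d f ?h + c * inner_L2 d g ?h"
    by (rule inner_L2_add_scale[OF f g L2_add_scale[OF f g]])
  also have "inner_L2 d f ?h = inner_L2 d f f + c * inner_L2 d g f"
    by (subst inner_L2_commute) (rule inner_L2_add_scale[OF f g f])
  also have "inner_L2 d g ?h = inner_L2 d g f + c * inner_L2 d g g"
    by (subst inner_L2_commute) (simp add: inner_L2_add_scale[OF f g g] inner_L2_commute[of d f g])
  finally show ?thesis by (simp only: norm_L2_power2) (simp add: power2_eq_square algebra_simps)
qed

text \<open>The polynomial \<open>F + 2 * c * C + c\<^sup>2 * G\<close> is nonnegative for every
  \<open>c\<close>. As \<open>norm_L2\<close> is only a seminorm on functions, a vanishing leading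
  coefficient \<open>G\<close> is treated separately.\<close>

lemma inner_L2_Cauchy_Schwarz:
  assumes f: "f \<in> L2 d" and g: "g \<in> L2 d"
  shows "\<bar>inner_L2 d f g\<bar> \<le> norm_L2 d f * norm_L2 d g"
proof -
  define F G C where "F = (norm_L2 d f)\<^sup>2" and "G = (norm_L2 d g)\<^sup>2" and "C = inner_L2 d f g"
  have "0 \<le> F + 2 * c * C + c\<^sup>2 * G" for c
    using norm_L2_add_scale_power2[OF f g, of c] inner_L2_commute[of d f g]
    by (simp add: F_def G_def C_def) (metis zero_le_power2)
  note quad = this
  have "C\<^sup>2 \<le> F * G"
  proof (cases "G = 0")
    case True
    have "C = 0"
    proof (rule ccontr)
      assume "C \<noteq> 0"
      \<comment> \<open>With \<open>G = 0\<close> this value of \<open>c\<close> makes the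
        polynomial equal to -1.\<close>
      then show False using quad[of "- (F + 1) / (2 * C)"] True by (simp add: field_simps)
    qed
    then show ?thesis using True by simp
  next
    case False
    then have "G > 0" by (simp add: G_def)
    \<comment> \<open>\<open>- C / G\<close> is the minimiser of the polynomial.\<close>
    then show ?thesis using quad[of "- C / G"] by (simp add: field_simps power2_eq_square)
  qed
  then have "\<bar>C\<bar>\<^sup>2 \<le> (norm_L2 d f * norm_L2 d g)\<^sup>2"
    by (simp add: F_def G_def power_mult_distrib)
  then show ?thesis
    unfolding C_def by (rule power2_le_imp_le) (simp add: norm_L2_nonneg)
qed

lemma norm_L2_triangle:
  assumes f: "f \<in> L2 d" and g: "g \<in> L2 d"
  shows "norm_L2 d (\<lambda>i k. f i k + g i k) \<le> norm_L2 d f + norm_L2 d g"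
proof (rule power2_le_imp_le)
  show "(norm_L2 d (\<lambda>i k. f i k + g i k))\<^sup>2 \<le> (norm_L2 d f + norm_L2 d g)\<^sup>2"
    using norm_L2_add_scale_power2[OF f g, of 1] inner_L2_Cauchy_Schwarz[OF g f]
    by (simp add: power2_sum mult.commute)
qed (simp add: norm_L2_nonneg)

lemma norm_L2_diff_ge:
  assumes f: "f \<in> L2 d" and g: "g \<in> L2 d"
  shows "\<bar>norm_L2 d f - norm_L2 d g\<bar> \<le> norm_L2 d (\<lambda>i k. f i k - g i k)"
proof -
  have "norm_L2 d (\<lambda>i k. f i k - g i k) = norm_L2 d (\<lambda>i k. g i k - f i k)"
    by (simp add: norm_L2_def inner_L2_def algebra_simps)
  then show ?thesis
    using norm_L2_triangle[OF L2_diff[OF f g] g] norm_L2_triangle[OF L2_diff[OF g f] f] by simp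
qed

subsection \<open>Balanced kernels\<close>

text \<open>
  A Lebesgue measurable kernel need not have measurable sections everywhere, so Fubini's theorem is
  applied to a product-measurable version \<open>B\<close> of it.  Both orders of the iterated almost-everywhere
  quantifiers are kept because balancedness involves the integrals over either variable.
\<close>

definition regular_kernel :: "(real \<Rightarrow> real \<Rightarrow> real) \<Rightarrow> bool"
  where "regular_kernel K \<longleftrightarrow> (\<exists>B. case_prod B \<in> borel_measurable (unit_int \<Otimes>\<^sub>M unit_int) \<and>
    (\<forall>i j. B i j \<in> {0..1}) \<and>
    (AE i in unit_int. AE j in unit_int. K i j = B i j) \<and>
    (AE j in unit_int. AE i in unit_int. K i j = B i j))"

text \<open>Null sets of \<open>lborel\<close> stay null in its completion, so what Fubini's theorem
  gives for Borel measures carries over to \<open>lebesgue_on\<close>.\<close>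

lemma AE_lebesgue_on_I:
  fixes S :: "'a::euclidean_space set"
  assumes "AE x in lborel. x \<in> S \<longrightarrow> P x" "S \<in> sets lebesgue"
  shows "AE x in lebesgue_on S. P x"
  using assms AE_completion[OF assms(1)] by (simp add: AE_restrict_space_iff)

text \<open>Extended by zero, \<open>a\<close> agrees with a Borel function \<open>g\<close> off a
  Borel null set \<open>N\<close> of the three-dimensional space. By Fubini almost every section of
  \<open>N\<close> at time \<open>t\<close> is null in the plane, and there \<open>g\<close>, cut
  off to the unit interval, is the required version.\<close>

lemma AE_regular_kernel_section:
  fixes a :: "real \<Rightarrow> real \<Rightarrow> real \<Rightarrow> real"
  assumes range: "\<And>t i j. t \<ge> 0 \<Longrightarrow> i \<in> {0..1} \<Longrightarrow> j \<in> {0..1} \<Longrightarrow> a t i j \<in> {0..1}"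
    and meas: "(\<lambda>(t, i, j). a t i j) \<in> borel_measurable (lebesgue_on ({0..} \<times> {0..1} \<times> {0..1}))"
  shows "AE t in lebesgue_on {0..}. regular_kernel (a t)"
proof -
  let ?S = "{0..} \<times> {0..1} \<times> {0..1} :: (real \<times> real \<times> real) set"
  let ?f = "\<lambda>x. if x \<in> ?S then (\<lambda>(t, i, j). a t i j) x else 0"
  interpret T: pair_sigma_finite "lborel :: real measure" "lborel \<Otimes>\<^sub>M lborel :: (real \<times> real) measure"
    by (simp add: lborel_prod pair_sigma_finite.intro sigma_finite_lborel)
  have prod: "(lborel :: (real \<times> real \<times> real) measure) = lborel \<Otimes>\<^sub>M (lborel \<Otimes>\<^sub>M lborel)"
    by (simp add: lborel_prod)
  have "closed ?S" by (intro closed_Times closed_atLeast closed_atLeastAtMost)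
  then have "?f \<in> borel_measurable lebesgue"
    using meas by (intro borel_measurable_if_I) (auto intro: borel_closed)
  then obtain g where g: "g \<in> borel_measurable lborel" and "AE x in lborel. ?f x = g x"
    using completion_ex_borel_measurable_real by blast
  then obtain N where N: "{x \<in> space lborel. ?f x \<noteq> g x} \<subseteq> N" "emeasure lborel N = 0" "N \<in> sets lborel"
    by (auto elim: AE_E)
  have gP [measurable]: "g \<in> borel_measurable (lborel \<Otimes>\<^sub>M (lborel \<Otimes>\<^sub>M lborel))"
    and NP [measurable]: "N \<in> sets (lborel \<Otimes>\<^sub>M (lborel \<Otimes>\<^sub>M lborel))"
    using g N(3) by (simp_all only: prod)
  have "AE x in lborel. x \<notin> N" using N by (intro AE_not_in) auto
  then have "AE x in lborel \<Otimes>\<^sub>M (lborel \<Otimes>\<^sub>M lborel). x \<notin> N" by (simp only: prod)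
  then have "AE t in lborel. AE p in lborel \<Otimes>\<^sub>M lborel. (t, p) \<notin> N" by (rule T.AE_pair)
  then have "AE t in lborel. t \<in> {0..} \<longrightarrow> regular_kernel (a t)"
  proof eventually_elim
    case (elim t)
    show ?case
    proof
      assume t: "t \<in> {0..}"
      \<comment> \<open>The truncation puts all values of \<open>B\<close> into
        \<open>{0..1}\<close>; off \<open>N\<close> and inside the square it changes nothing,
        because \<open>a\<close> has values in \<open>{0..1}\<close>.\<close>
      define B where "B i j = max 0 (min 1 (g (t, i, j)))" for i j
      have eq: "a t i j = B i j" if "i \<in> {0..1}" "j \<in> {0..1}" "(t, i, j) \<notin> N" for i j
        using N(1) range[of t i j] that t by (force simp: B_def)
      have ij: "AE i in lborel. AE j in lborel. (t, i, j) \<notin> N"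
        using lborel_pair.AE_pair[OF elim] .
      \<comment> \<open>Exchanging the two almost-everywhere quantifiers requires a set measurable
        in the product; the complement of a section of the Borel set \<open>N\<close> is
        one.\<close>
      have "{p \<in> space (lborel \<Otimes>\<^sub>M lborel). (t, fst p, snd p) \<notin> N} \<in> sets (lborel \<Otimes>\<^sub>M lborel)"
        by measurable
      then have ji: "AE j in lborel. AE i in lborel. (t, i, j) \<notin> N"
        using ij by (simp only: lborel_pair.AE_commute)
      have "AE i in unit_int. AE j in unit_int. a t i j = B i j"
      proof (rule AE_lebesgue_on_I)
        show "AE i in lborel. i \<in> {0..1} \<longrightarrow> (AE j in unit_int. a t i j = B i j)"
          using ij
        proof eventually_elim
          case (elim i)
          show ?case
          proof
            assume "i \<in> {0..1}"
            then have "AE j in lborel. j \<in> {0..1} \<longrightarrow> a t i j = B i j"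
              using elim eq by (auto elim!: eventually_mono)
            then show "AE j in unit_int. a t i j = B i j" by (rule AE_lebesgue_on_I) simp
          qed
        qed
      qed simp
      moreover have "AE j in unit_int. AE i in unit_int. a t i j = B i j"
      proof (rule AE_lebesgue_on_I)
        show "AE j in lborel. j \<in> {0..1} \<longrightarrow> (AE i in unit_int. a t i j = B i j)"
          using ji
        proof eventually_elim
          case (elim j)
          show ?case
          proof
            assume "j \<in> {0..1}"
            then have "AE i in lborel. i \<in> {0..1} \<longrightarrow> a t i j = B i j"
              using elim eq by (auto elim!: eventually_mono)
            then show "AE i in unit_int. a t i j = B i j" by (rule AE_lebesgue_on_I) simp
          qed
        qed
      qed simp
      moreover have "case_prod B \<in> borel_measurable (unit_int \<Otimes>\<^sub>M unit_int)"
      proof -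
        \<comment> \<open>The identity is measurable from the Lebesgue to the Borel sets, so the
          Borel function \<open>g\<close> gives a function measurable for
          \<open>unit_int \<Otimes>\<^sub>M unit_int\<close>.\<close>
        have id: "(\<lambda>x. x) \<in> measurable unit_int lborel"
          by (rule measurable_restrict_space1) (rule measurable_completion, simp)
        have "(\<lambda>p. (t, fst p, snd p)) \<in> measurable (unit_int \<Otimes>\<^sub>M unit_int) (lborel \<Otimes>\<^sub>M (lborel \<Otimes>\<^sub>M lborel))"
          by (intro measurable_Pair measurable_const measurable_compose[OF measurable_fst id]
              measurable_compose[OF measurable_snd id]) simp
        from measurable_compose[OF this gP] show ?thesis
          by (simp add: B_def case_prod_unfold)
      qed
      ultimately show "regular_kernel (a t)"
        unfolding regular_kernel_def by (intro exI[of _ B]) (auto simp: B_def)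
    qed
  qed
  then show ?thesis by (rule AE_lebesgue_on_I) simp
qed

text \<open>Completeness of Lebesgue measure: a change on a null set preserves
  measurability.\<close>

lemma borel_measurable_lebesgue_on_AE:
  fixes f g :: "'a::euclidean_space \<Rightarrow> 'b::euclidean_space"
  assumes f: "f \<in> borel_measurable (lebesgue_on S)" and S: "S \<in> sets lebesgue"
    and eq: "AE x in lebesgue_on S. f x = g x"
  shows "g \<in> borel_measurable (lebesgue_on S)"
proof -
  have "(\<lambda>x. if x \<in> S then f x else 0) \<in> borel_measurable lebesgue"
    using borel_measurable_if_I[OF f S] .
  moreover have "AE x in lebesgue. (if x \<in> S then f x else 0) = (if x \<in> S then g x else 0)"
    using eq S by (auto simp: AE_restrict_space_iff elim!: eventually_mono)
  ultimately have "(\<lambda>x. if x \<in> S then g x else 0) \<in> borel_measurable lebesgue"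
    by (rule borel_measurable_AE)
  then show ?thesis by (rule borel_measurable_if_D)
qed

text \<open>Measurability is asked of \<open>f\<close> alone and passes to \<open>g\<close>.
  Integrals over sections of the original kernel can thus be replaced by integrals over sections of
  \<open>B\<close>.\<close>

lemma integral_lebesgue_on_cong_AE:
  fixes f g :: "'a::euclidean_space \<Rightarrow> 'b::euclidean_space"
  assumes f: "f \<in> borel_measurable (lebesgue_on S)" and S: "S \<in> sets lebesgue"
    and eq: "AE x in lebesgue_on S. f x = g x"
  shows "integral\<^sup>L (lebesgue_on S) g = integral\<^sup>L (lebesgue_on S) f"
  using borel_measurable_lebesgue_on_AE[OF assms] f eq
  by (intro integral_cong_AE) (auto elim: eventually_mono)

text \<open>Balancedness makes the row and column integrals of the kernel equal. Hence the mean of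
  the Laplacian cancels, and its quadratic form is half the double integral of
  \<open>B i j * (f i k - f j k)\<^sup>2\<close>, summed over \<open>k\<close>.\<close>

lemma laplacian_balanced:
  assumes K: "regular_kernel (a t)" and bal: "balanced (a t)" and f: "f \<in> L2 d"
  shows "k < d \<Longrightarrow> mean (graph_laplacian a t f) k = 0"
    and "inner_L2 d (graph_laplacian a t f) f \<ge> 0"
proof -
  interpret I: finite_measure unit_int by (rule finite_measure_lebesgue_on) simp
  interpret P: pair_sigma_finite unit_int unit_int ..
  obtain B where Bm: "case_prod B \<in> borel_measurable (unit_int \<Otimes>\<^sub>M unit_int)"
    and B01: "\<And>i j. B i j \<in> {0..1}"
    and KB: "AE i in unit_int. AE j in unit_int. a t i j = B i j"
    and KB': "AE j in unit_int. AE i in unit_int. a t i j = B i j"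
    using K unfolding regular_kernel_def by blast
  have fst_m: "(\<lambda>p. u (fst p)) \<in> borel_measurable (unit_int \<Otimes>\<^sub>M unit_int)"
    and snd_m: "(\<lambda>p. u (snd p)) \<in> borel_measurable (unit_int \<Otimes>\<^sub>M unit_int)"
    if "u \<in> borel_measurable unit_int" for u :: "real \<Rightarrow> real"
    using that by (auto intro: measurable_compose[OF measurable_fst] measurable_compose[OF measurable_snd])
  have Bsec: "(\<lambda>j. B i j) \<in> borel_measurable unit_int" "(\<lambda>j. B j i) \<in> borel_measurable unit_int"
    if "i \<in> {0..1}" for i
    using measurable_compose[OF measurable_Pair1' Bm, of i] measurable_compose[OF measurable_Pair2' Bm, of i] that
    by simp_all
  \<comment> \<open>Since \<open>B\<close> lies between 0 and 1, the integrand is dominated by the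
    absolute value of \<open>u i * v j\<close>, a product of functions of separate
    variables.\<close>
  have int: "integrable (unit_int \<Otimes>\<^sub>M unit_int) (\<lambda>(i, j). B i j * (u i * v j))"
    if u: "integrable unit_int u" and v: "integrable unit_int v" for u v
  proof (rule Bochner_Integration.integrable_bound)
    show "integrable (unit_int \<Otimes>\<^sub>M unit_int) (\<lambda>p. u (fst p) * v (snd p))"
    proof (rule P.Fubini_integrable)
      show "(\<lambda>p. u (fst p) * v (snd p)) \<in> borel_measurable (unit_int \<Otimes>\<^sub>M unit_int)"
        using u v by (intro borel_measurable_times fst_m snd_m) auto
    qed (use u v in \<open>simp_all add: abs_mult\<close>)
    show "(\<lambda>(i, j). B i j * (u i * v j)) \<in> borel_measurable (unit_int \<Otimes>\<^sub>M unit_int)"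
      using u v Bm unfolding case_prod_unfold
      by (intro borel_measurable_times fst_m snd_m) auto
    have "B i j * (\<bar>u i\<bar> * \<bar>v j\<bar>) \<le> \<bar>u i\<bar> * \<bar>v j\<bar>" for i j
      using B01[of i j] by (intro mult_left_le_one_le) auto
    then show "AE p in unit_int \<Otimes>\<^sub>M unit_int.
        norm (case p of (i, j) \<Rightarrow> B i j * (u i * v j)) \<le> norm (u (fst p) * v (snd p))"
      using B01 by (auto simp: abs_mult)
  qed
  \<comment> \<open>The bilinear form of the kernel \<open>B\<close>; both claims reduce to
    identities between its values.\<close>
  define J where "J u v = integral\<^sup>L (unit_int \<Otimes>\<^sub>M unit_int) (\<lambda>(i, j). B i j * (u i * v j))"
    for u v :: "real \<Rightarrow> real"
  have one: "integrable unit_int (\<lambda>_. 1::real)" by simp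
  have balB: "AE i in unit_int. (LINT j|unit_int. B i j) = (LINT j|unit_int. B j i)"
    using bal[unfolded balanced_def] KB KB' AE_space
  proof eventually_elim
    case (elim i)
    then have i: "i \<in> {0..1}" by simp
    have "(LINT j|unit_int. a t i j) = (LINT j|unit_int. B i j)"
      by (rule integral_lebesgue_on_cong_AE[OF Bsec(1)[OF i]])
        (use elim(2) in \<open>auto elim: eventually_mono\<close>)
    moreover have "(LINT j|unit_int. a t j i) = (LINT j|unit_int. B j i)"
      by (rule integral_lebesgue_on_cong_AE[OF Bsec(2)[OF i]])
        (use elim(3) in \<open>auto elim: eventually_mono\<close>)
    ultimately show ?case using elim(1) by simp
  qed
  \<comment> \<open>Integrating out the variable carrying the constant 1 leaves \<open>u\<close>
    times the row integral, respectively the column integral, of \<open>B\<close>.\<close>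
  have swap: "J u (\<lambda>_. 1) = J (\<lambda>_. 1) u" if u: "integrable unit_int u" for u
  proof -
    have "J u (\<lambda>_. 1) = (LINT i|unit_int. LINT j|unit_int. B i j * (u i * 1))"
      unfolding J_def using P.integral_fst[OF int[OF u one]] by simp
    also have "\<dots> = (LINT i|unit_int. LINT j|unit_int. B j i * (1 * u i))"
    proof (rule integral_cong_AE)
      show "(\<lambda>i. LINT j|unit_int. B i j * (u i * 1)) \<in> borel_measurable unit_int"
        using P.integrable_fst[OF int[OF u one]] by auto
      show "(\<lambda>i. LINT j|unit_int. B j i * (1 * u i)) \<in> borel_measurable unit_int"
        using P.integrable_snd[OF int[OF one u]] by auto
      show "AE i in unit_int. (LINT j|unit_int. B i j * (u i * 1)) = (LINT j|unit_int. B j i * (1 * u i))"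
        using balB by eventually_elim simp
    qed
    also have "\<dots> = J (\<lambda>_. 1) u"
      unfolding J_def using P.integral_snd[OF int[OF one u]] by simp
    finally show ?thesis .
  qed
  \<comment> \<open>The Laplacian of \<open>f\<close> formed with \<open>B\<close>: measurable by
    Fubini, and almost everywhere equal to the original one.\<close>
  define G where "G k i = (LINT j|unit_int. B i j * (f i k - f j k))" for k i
  have fi: "integrable unit_int (\<lambda>i. f i k)" if "k < d" for k
    using integrable_L2_coord[OF f that] .
  have ff: "integrable unit_int (\<lambda>i. f i k * f i k)" if "k < d" for k
    using L2_integrable_mult[OF f f that] .
  have LG: "AE i in unit_int. graph_laplacian a t f i k = G k i" if k: "k < d" for k
    using KB AE_space
  proof eventually_elim
    case (elim i)
    have "AE j in unit_int. B i j * (f i k - f j k) = a t i j * (f i k - f j k)"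
      using elim(1) by eventually_elim simp
    then show ?case
      unfolding G_def graph_laplacian_def using Bsec(1)[of i] elim(2) L2D(1)[OF f k]
      by (intro integral_lebesgue_on_cong_AE) auto
  qed
  show "mean (graph_laplacian a t f) k = 0" if k: "k < d"
  proof -
    have int1: "integrable (unit_int \<Otimes>\<^sub>M unit_int) (\<lambda>(i, j). B i j * (f i k - f j k))"
      using Bochner_Integration.integrable_diff[OF int[OF fi one] int[OF one fi], of k k] k
      by (simp add: case_prod_unfold algebra_simps)
    have "mean (graph_laplacian a t f) k = integral\<^sup>L unit_int (G k)"
      unfolding mean_def
    proof (rule integral_lebesgue_on_cong_AE)
      show "G k \<in> borel_measurable unit_int"
        unfolding G_def using P.integrable_fst[OF int1] by auto
      show "AE i in unit_int. G k i = graph_laplacian a t f i k"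
        using LG[OF k] by eventually_elim simp
    qed simp
    also have "\<dots> = (LINT (i,j)|(unit_int \<Otimes>\<^sub>M unit_int). B i j * (f i k - f j k))"
      unfolding G_def by (rule P.integral_fst[OF int1])
    also have "\<dots> = J (\<lambda>i. f i k) (\<lambda>_. 1) - J (\<lambda>_. 1) (\<lambda>i. f i k)"
      unfolding J_def
      by (subst Bochner_Integration.integral_diff[symmetric])
        (use int[OF fi one] int[OF one fi] k in \<open>auto simp: case_prod_unfold algebra_simps\<close>)
    also have "\<dots> = 0" using swap[OF fi[OF k]] by simp
    finally show ?thesis .
  qed
  have GI: "integrable unit_int (\<lambda>i. G k i * f i k)" and G0: "(LINT i|unit_int. G k i * f i k) \<ge> 0"
    if k: "k < d" for k
  proof -
    let ?u = "\<lambda>i. f i k"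
    note ints = int[OF ff one, of k] int[OF fi fi, of k k] int[OF one ff, of k]
    have int2: "integrable (unit_int \<Otimes>\<^sub>M unit_int) (\<lambda>(i, j). B i j * (f i k - f j k) * f i k)"
      using Bochner_Integration.integrable_diff[OF ints(1,2)] k
      by (simp add: case_prod_unfold algebra_simps)
    have eq: "G k i * f i k = (LINT j|unit_int. B i j * (f i k - f j k) * f i k)" for i
      by (simp add: G_def)
    show "integrable unit_int (\<lambda>i. G k i * f i k)"
      unfolding eq by (rule P.integrable_fst[OF int2])
    have "(LINT i|unit_int. G k i * f i k) =
        (LINT (i,j)|(unit_int \<Otimes>\<^sub>M unit_int). B i j * (f i k - f j k) * f i k)"
      unfolding eq by (rule P.integral_fst[OF int2])
    also have "\<dots> = J (\<lambda>i. ?u i * ?u i) (\<lambda>_. 1) - J ?u ?u"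
      unfolding J_def
      by (subst Bochner_Integration.integral_diff[symmetric])
        (use ints k in \<open>auto simp: case_prod_unfold algebra_simps\<close>)
    finally have L: "(LINT i|unit_int. G k i * f i k) = J (\<lambda>i. ?u i * ?u i) (\<lambda>_. 1) - J ?u ?u" .
    \<comment> \<open>Expanding the square gives
      \<open>J (u * u) 1 - 2 * J u u + J 1 (u * u)\<close>, which by \<open>swap\<close> is twice
      the quadratic form \<open>J (u * u) 1 - J u u\<close>.\<close>
    have "0 \<le> (LINT p|(unit_int \<Otimes>\<^sub>M unit_int). B (fst p) (snd p) * (?u (fst p) - ?u (snd p))\<^sup>2)"
      using B01 by (intro integral_nonneg_AE) simp
    also have "\<dots> = (LINT p|(unit_int \<Otimes>\<^sub>M unit_int). (case p of (i, j) \<Rightarrow> B i j * ((?u i * ?u i) * 1))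
        - (2 * (case p of (i, j) \<Rightarrow> B i j * (?u i * ?u j)) - (case p of (i, j) \<Rightarrow> B i j * (1 * (?u j * ?u j)))))"
      by (intro Bochner_Integration.integral_cong) (auto simp: case_prod_unfold power2_eq_square algebra_simps)
    also have "\<dots> = J (\<lambda>i. ?u i * ?u i) (\<lambda>_. 1) - (2 * J ?u ?u - J (\<lambda>_. 1) (\<lambda>i. ?u i * ?u i))"
      unfolding J_def using ints k
      by (simp del: mult_1_left mult_1_right)
    finally show "(LINT i|unit_int. G k i * f i k) \<ge> 0"
      unfolding L using swap[OF ff[OF k]] by simp
  qed
  have "inner_L2 d (graph_laplacian a t f) f = (LINT i|unit_int. (\<Sum>k<d. G k i * f i k))"
    unfolding inner_L2_def
  proof (rule integral_lebesgue_on_cong_AE)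
    show "(\<lambda>i. \<Sum>k<d. G k i * f i k) \<in> borel_measurable unit_int"
      using GI by (intro borel_measurable_sum) auto
    have "AE i in unit_int. \<forall>k\<in>{..<d}. graph_laplacian a t f i k = G k i"
      using LG by (intro AE_finite_allI) auto
    then show "AE i in unit_int. (\<Sum>k<d. G k i * f i k) = (\<Sum>k<d. graph_laplacian a t f i k * f i k)"
      by eventually_elim simp
  qed simp
  also have "\<dots> = (\<Sum>k<d. LINT i|unit_int. G k i * f i k)"
    using GI by (intro Bochner_Integration.integral_sum) auto
  also have "\<dots> \<ge> 0" using G0 by (intro sum_nonneg) auto
  finally show "inner_L2 d (graph_laplacian a t f) f \<ge> 0" .
qed

subsection \<open>Curves in L2\<close>

lemma L2_scale: "f \<in> L2 d \<Longrightarrow> (\<lambda>i k. c * f i k) \<in> L2 d"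
  using L2_add_scale[OF L2_const[of "\<lambda>_. 0"], of f d c] by simp

lemma has_L2_derivative_remainder:
  assumes L2: "\<And>s. s \<ge> 0 \<Longrightarrow> x s \<in> L2 d" and deriv: "has_L2_derivative d x v t" and t: "t \<ge> 0"
  obtains q where "\<And>s. s \<ge> 0 \<Longrightarrow> q s \<in> L2 d"
    and "((\<lambda>s. norm_L2 d (q s)) \<longlongrightarrow> 0) (at t within {0..})"
    and "\<And>s. x s = (\<lambda>i k. x t i k + (s - t) * (v i k + q s i k))"
proof
  let ?q = "\<lambda>s i k. (x s i k - x t i k) / (s - t) - v i k"
  have v: "v \<in> L2 d" and "((\<lambda>s. norm_L2 d (?q s)) \<longlongrightarrow> 0) (at t within {0..})"
    using deriv by (simp_all add: has_L2_derivative_def)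
  then show "((\<lambda>s. norm_L2 d (?q s)) \<longlongrightarrow> 0) (at t within {0..})" by simp
  show "?q s \<in> L2 d" if "s \<ge> 0" for s
    using L2_diff[OF L2_scale[OF L2_diff[OF L2[OF that] L2[OF t]], of "1 / (s - t)"] v] by simp
  \<comment> \<open>At \<open>s = t\<close> division by zero makes the remainder \<open>- v\<close>,
    which the factor \<open>s - t\<close> removes.\<close>
  show "x s = (\<lambda>i k. x t i k + (s - t) * (v i k + ?q s i k))" for s
    by (cases "s = t") (simp_all add: fun_eq_iff)
qed

text \<open>With \<open>x s = x t + (s - t) * (v + q s)\<close>, the error of the difference
  quotient is twice the inner product of \<open>q s\<close> and \<open>x t\<close> plus
  \<open>s - t\<close> times the squared norm of \<open>v + q s\<close>. Cauchy-Schwarz and the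
  triangle inequality bound it by \<open>b s\<close>, which tends to 0.\<close>

lemma norm_L2_power2_has_derivative:
  assumes L2: "\<And>s. s \<ge> 0 \<Longrightarrow> x s \<in> L2 d" and deriv: "has_L2_derivative d x v t" and t: "t \<ge> 0"
  shows "((\<lambda>s. (norm_L2 d (x s))\<^sup>2) has_real_derivative 2 * inner_L2 d v (x t)) (at t within {0..})"
proof -
  have v: "v \<in> L2 d" using deriv by (simp add: has_L2_derivative_def)
  obtain q where q: "\<And>s. s \<ge> 0 \<Longrightarrow> q s \<in> L2 d"
    and q0: "((\<lambda>s. norm_L2 d (q s)) \<longlongrightarrow> 0) (at t within {0..})"
    and x_eq: "\<And>s. x s = (\<lambda>i k. x t i k + (s - t) * (v i k + q s i k))"
    using has_L2_derivative_remainder[OF L2 deriv t] by blast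
  define b where "b s = 2 * (norm_L2 d (q s) * norm_L2 d (x t)) +
    \<bar>s - t\<bar> * (norm_L2 d v + norm_L2 d (q s))\<^sup>2" for s
  have "((\<lambda>s. b s) \<longlongrightarrow> 2 * (0 * norm_L2 d (x t)) + \<bar>t - t\<bar> * (norm_L2 d v + 0)\<^sup>2) (at t within {0..})"
    unfolding b_def by (intro tendsto_intros q0)
  then have b0: "(b \<longlongrightarrow> 0) (at t within {0..})" by simp
  have "\<bar>((norm_L2 d (x s))\<^sup>2 - (norm_L2 d (x t))\<^sup>2) / (s - t) - 2 * inner_L2 d v (x t)\<bar> \<le> \<bar>b s\<bar>"
    if s: "s \<ge> 0" "s \<noteq> t" for s
  proof -
    let ?vq = "\<lambda>i k. v i k + q s i k"
    have vq: "?vq \<in> L2 d" using L2_add_scale[OF v q[OF s(1)], of 1] by simp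
    have "(norm_L2 d (x s))\<^sup>2 = (norm_L2 d (x t))\<^sup>2 + 2 * (s - t) * inner_L2 d ?vq (x t)
        + (s - t)\<^sup>2 * (norm_L2 d ?vq)\<^sup>2"
      using norm_L2_add_scale_power2[OF L2[OF t] vq, of "s - t"] x_eq[of s] by simp
    also have "inner_L2 d ?vq (x t) = inner_L2 d v (x t) + inner_L2 d (q s) (x t)"
      using inner_L2_add_scale[OF v q[OF s(1)] L2[OF t], of 1] by simp
    finally have "((norm_L2 d (x s))\<^sup>2 - (norm_L2 d (x t))\<^sup>2) / (s - t) - 2 * inner_L2 d v (x t) =
        2 * inner_L2 d (q s) (x t) + (s - t) * (norm_L2 d ?vq)\<^sup>2"
      using s(2) by (simp add: field_simps power2_eq_square)
    also have "\<bar>\<dots>\<bar> \<le> 2 * \<bar>inner_L2 d (q s) (x t)\<bar> + \<bar>s - t\<bar> * (norm_L2 d ?vq)\<^sup>2"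
      by (rule order_trans[OF abs_triangle_ineq]) (simp add: abs_mult)
    also have "\<dots> \<le> b s"
      unfolding b_def
      using inner_L2_Cauchy_Schwarz[OF q[OF s(1)] L2[OF t]] norm_L2_triangle[OF v q[OF s(1)]]
      by (intro add_mono mult_left_mono power_mono) (auto simp: norm_L2_nonneg)
    also have "\<dots> \<le> \<bar>b s\<bar>" by simp
    finally show ?thesis .
  qed
  then have "((\<lambda>s. ((norm_L2 d (x s))\<^sup>2 - (norm_L2 d (x t))\<^sup>2) / (s - t) - 2 * inner_L2 d v (x t))
      \<longlongrightarrow> 0) (at t within {0..})"
    by (intro tendsto_0_le[OF b0, of _ 1]) (auto simp: eventually_at_filter intro!: always_eventually)
  then show ?thesis
    unfolding has_field_derivative_iff by (simp add: LIM_zero_iff)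
qed

text \<open>The error of the difference quotient is exactly \<open>inner_L2 d (q s) w\<close>. A
  coordinate function as \<open>w\<close> turns this into the derivative of the mean.\<close>

lemma inner_L2_has_derivative:
  assumes L2: "\<And>s. s \<ge> 0 \<Longrightarrow> x s \<in> L2 d" and deriv: "has_L2_derivative d x v t" and t: "t \<ge> 0"
    and w: "w \<in> L2 d"
  shows "((\<lambda>s. inner_L2 d (x s) w) has_real_derivative inner_L2 d v w) (at t within {0..})"
proof -
  have v: "v \<in> L2 d" using deriv by (simp add: has_L2_derivative_def)
  obtain q where q: "\<And>s. s \<ge> 0 \<Longrightarrow> q s \<in> L2 d"
    and q0: "((\<lambda>s. norm_L2 d (q s)) \<longlongrightarrow> 0) (at t within {0..})"
    and x_eq: "\<And>s. x s = (\<lambda>i k. x t i k + (s - t) * (v i k + q s i k))"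
    using has_L2_derivative_remainder[OF L2 deriv t] by blast
  have "\<bar>(inner_L2 d (x s) w - inner_L2 d (x t) w) / (s - t) - inner_L2 d v w\<bar>
      \<le> norm_L2 d (q s) * norm_L2 d w"
    if s: "s \<ge> 0" "s \<noteq> t" for s
  proof -
    let ?vq = "\<lambda>i k. v i k + q s i k"
    have vq: "?vq \<in> L2 d" using L2_add_scale[OF v q[OF s(1)], of 1] by simp
    have "inner_L2 d (x s) w = inner_L2 d (x t) w + (s - t) * inner_L2 d ?vq w"
      using inner_L2_add_scale[OF L2[OF t] vq w, of "s - t"] x_eq[of s] by simp
    also have "inner_L2 d ?vq w = inner_L2 d v w + inner_L2 d (q s) w"
      using inner_L2_add_scale[OF v q[OF s(1)] w, of 1] by simp
    finally have "(inner_L2 d (x s) w - inner_L2 d (x t) w) / (s - t) - inner_L2 d v w = inner_L2 d (q s) w"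
      using s(2) by (simp add: field_simps)
    then show ?thesis using inner_L2_Cauchy_Schwarz[OF q[OF s(1)] w] by simp
  qed
  then have "((\<lambda>s. (inner_L2 d (x s) w - inner_L2 d (x t) w) / (s - t) - inner_L2 d v w)
      \<longlongrightarrow> 0) (at t within {0..})"
    by (intro tendsto_0_le[OF q0, of _ "norm_L2 d w"])
      (auto simp: eventually_at_filter norm_L2_nonneg intro!: always_eventually)
  then show ?thesis
    unfolding has_field_derivative_iff by (simp add: LIM_zero_iff)
qed

text \<open>Compactness of \<open>{0..T}\<close> makes the local Lipschitz constants uniform. The
  general \<phi> covers both the mean and the norm of the distance to a constant.\<close>

lemma Lip_loc_L2_imp_lipschitz:
  fixes \<phi> :: "real \<Rightarrow> real"
  assumes x: "Lip_loc_L2 d x" and C: "C \<ge> 0"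
    and \<phi>: "\<And>r s. r \<ge> 0 \<Longrightarrow> s \<ge> 0 \<Longrightarrow> \<bar>\<phi> s - \<phi> r\<bar> \<le> C * norm_L2 d (\<lambda>i k. x s i k - x r i k)"
  obtains L where "L-lipschitz_on {0..T} \<phi>"
proof -
  have "\<exists>u>0. \<exists>L. L-lipschitz_on (cball t u \<inter> {0..T}) \<phi>" if "t \<in> {0..T}" for t
  proof -
    have "\<exists>\<epsilon>>0. \<exists>K. \<forall>r \<in> {0..} \<inter> ball t \<epsilon>. \<forall>s \<in> {0..} \<inter> ball t \<epsilon>.
        norm_L2 d (\<lambda>i k. x s i k - x r i k) \<le> K * \<bar>s - r\<bar>"
      using x that by (simp add: Lip_loc_L2_def)
    then obtain \<epsilon> K where \<epsilon>: "\<epsilon> > 0" and K: "\<And>r s. r \<in> {0..} \<inter> ball t \<epsilon> \<Longrightarrow> s \<in> {0..} \<inter> ball t \<epsilon> \<Longrightarrow>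
        norm_L2 d (\<lambda>i k. x s i k - x r i k) \<le> K * \<bar>s - r\<bar>"
      by blast
    \<comment> \<open>Halving the radius fits a closed ball into the open one; the absolute value
      guards against a negative \<open>K\<close>.\<close>
    have "(C * \<bar>K\<bar>)-lipschitz_on (cball t (\<epsilon> / 2) \<inter> {0..T}) \<phi>"
    proof (rule lipschitz_onI)
      fix s r assume sr: "s \<in> cball t (\<epsilon> / 2) \<inter> {0..T}" "r \<in> cball t (\<epsilon> / 2) \<inter> {0..T}"
      then have "norm_L2 d (\<lambda>i k. x s i k - x r i k) \<le> K * \<bar>s - r\<bar>"
        using \<epsilon> by (intro K) auto
      also have "\<dots> \<le> \<bar>K\<bar> * \<bar>s - r\<bar>" by (intro mult_right_mono) auto
      finally have "C * norm_L2 d (\<lambda>i k. x s i k - x r i k) \<le> C * (\<bar>K\<bar> * \<bar>s - r\<bar>)"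
        using C by (rule mult_left_mono)
      then show "dist (\<phi> s) (\<phi> r) \<le> C * \<bar>K\<bar> * dist s r"
        using \<phi>[of r s] sr by (simp add: dist_real_def mult.assoc)
    qed (use C in simp)
    then show ?thesis using \<epsilon> by (intro exI[of _ "\<epsilon> / 2"]) auto
  qed
  \<comment> \<open>The parameter set of \<open>local_lipschitz\<close> is a dummy
    singleton.\<close>
  then have "local_lipschitz {0::real} {0..T} (\<lambda>_. \<phi>)"
    unfolding local_lipschitz_def by fastforce
  then obtain L where "\<And>t. t \<in> {0::real} \<Longrightarrow> L-lipschitz_on {0..T} \<phi>"
    by (rule local_lipschitz_compact_implies_lipschitz) auto
  then show thesis using that by blast
qed

text \<open>Turns almost-everywhere assumptions into the exceptional set that
  \<open>lipschitz_diff_le_integral\<close> expects.\<close>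

lemma AE_lebesgue_on_negligibleE:
  fixes S :: "'a::euclidean_space set"
  assumes "AE x in lebesgue_on S. P x" "S \<in> sets lebesgue"
  obtains N where "negligible N" "\<And>x. x \<in> S - N \<Longrightarrow> P x"
proof -
  have "AE x in lebesgue. x \<in> S \<longrightarrow> P x"
    using assms by (simp add: AE_restrict_space_iff)
  then obtain N where "{x \<in> space lebesgue. \<not> (x \<in> S \<longrightarrow> P x)} \<subseteq> N" "N \<in> null_sets lebesgue"
    by (auto elim!: AE_E simp: null_sets_def)
  then show thesis using that[of N] by (auto simp: negligible_iff_null_sets)
qed

section \<open>Means, the spectral gap and conservation of the mean\<close>

lemma mean_eq_inner_L2:
  "k < d \<Longrightarrow> mean f k = inner_L2 d f (\<lambda>_ l. if l = k then 1 else 0)"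
  by (simp add: mean_def inner_L2_def if_distrib cong: if_cong)

lemma mean_diff_const:
  assumes "f \<in> L2 d" "k < d"
  shows "mean (\<lambda>i k. f i k - c k) k = mean f k - c k"
proof -
  interpret finite_measure unit_int by (rule finite_measure_lebesgue_on) simp
  show ?thesis
    using integrable_L2_coord[OF assms] by (simp add: mean_def measure_restrict_space)
qed

text \<open>The infimum lies below the Rayleigh quotient of \<open>f\<close>. A real infimum is a
  lower bound only for a set bounded below, which the nonnegative quadratic form provides.\<close>

lemma lambda2_le:
  assumes K: "regular_kernel (a t)" and bal: "balanced (a t)"
    and f: "f \<in> L2 d" and mean: "\<And>k. k < d \<Longrightarrow> mean f k = 0"
  shows "lambda2 d (graph_laplacian a t) * (norm_L2 d f)\<^sup>2 \<le> inner_L2 d (graph_laplacian a t f) f"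
proof (cases "norm_L2 d f = 0")
  case True
  then show ?thesis using laplacian_balanced(2)[where a = a and t = t, OF K bal f] by simp
next
  case False
  have "\<not> eq_L2 d f (\<lambda>_ _. 0)"
  proof
    assume "eq_L2 d f (\<lambda>_ _. 0)"
    then have "AE i in unit_int. (\<Sum>k<d. f i k * f i k) = 0"
      unfolding eq_L2_def by eventually_elim simp
    then have "inner_L2 d f f = 0"
      unfolding inner_L2_def by (rule integral_eq_zero_AE)
    then show False using False by (simp add: norm_L2_def)
  qed
  then have "lambda2 d (graph_laplacian a t) \<le> inner_L2 d (graph_laplacian a t f) f / (norm_L2 d f)\<^sup>2"
    unfolding lambda2_def
  proof (intro cINF_lower bdd_belowI2[of _ 0])
    show "0 \<le> inner_L2 d (graph_laplacian a t g) g / (norm_L2 d g)\<^sup>2"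
      if "g \<in> {f \<in> constants_perp d. \<not> eq_L2 d f (\<lambda>_ _. 0)}" for g
      using laplacian_balanced(2)[where a = a and t = t and f = g and d = d, OF K bal] that by (simp add: constants_perp_def)
  qed (use f mean in \<open>simp add: constants_perp_eq\<close>)
  then show ?thesis using False by (simp add: pos_le_divide_eq)
qed

text \<open>On numbers at least \<open>c\<close> the logarithm is Lipschitz with constant
  \<open>1 / c\<close>, by \<open>ln u - ln v \<le> (u - v) / v\<close>.\<close>

lemma lipschitz_on_ln:
  fixes f :: "'a::metric_space \<Rightarrow> real"
  assumes f: "L-lipschitz_on X f" and c: "c > 0" "\<And>t. t \<in> X \<Longrightarrow> f t \<ge> c"
  shows "(L / c)-lipschitz_on X (\<lambda>t. ln (f t))"
proof (rule lipschitz_onI)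
  have *: "ln u - ln v \<le> \<bar>u - v\<bar> / c" if "u \<ge> c" "v \<ge> c" for u v :: real
  proof -
    have "ln u - ln v \<le> (u - v) / v" using that c by (intro ln_diff_le) auto
    also have "\<dots> \<le> \<bar>u - v\<bar> / v" using that c by (intro divide_right_mono) auto
    also have "\<dots> \<le> \<bar>u - v\<bar> / c" using that c by (intro divide_left_mono) auto
    finally show ?thesis .
  qed
  fix s t assume st: "s \<in> X" "t \<in> X"
  have "dist (ln (f s)) (ln (f t)) \<le> dist (f s) (f t) / c"
    using *[of "f s" "f t"] *[of "f t" "f s"] c(2) st
    by (simp add: dist_real_def abs_le_iff abs_minus_commute)
  also have "\<dots> \<le> L * dist s t / c"
    using lipschitz_onD[OF f st] c by (intro divide_right_mono) auto
  finally show "dist (ln (f s)) (ln (f t)) \<le> L / c * dist s t" by simp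
next
  show "0 \<le> L / c" using lipschitz_on_nonneg[OF f] c by simp
qed

text \<open>The mean is the inner product with a coordinate function. It is Lipschitz on compact
  intervals, with derivative almost everywhere minus the mean of the Laplacian, hence 0.\<close>

lemma solution_mean:
  assumes sol: "is_solution d a x0 x" and t: "t \<ge> 0" and k: "k < d"
    and good: "AE t in lebesgue_on {0..}. regular_kernel (a t) \<and> balanced (a t)"
  shows "mean (x t) k = mean x0 k"
proof -
  have lip: "Lip_loc_L2 d x" and init: "eq_L2 d (x 0) x0"
    and deriv: "AE t in lebesgue_on {0..}. has_L2_derivative d x (\<lambda>i k. - graph_laplacian a t (x t) i k) t"
    using sol by (auto simp: is_solution_def)
  have L2: "x s \<in> L2 d" if "s \<ge> 0" for s using lip that by (simp add: Lip_loc_L2_def)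
  define w where "w = (\<lambda>(_::real) l. if l = k then 1 else 0 :: real)"
  have w: "w \<in> L2 d" unfolding w_def by (rule L2_const)
  have mean_w: "mean f k = inner_L2 d f w" for f
    using mean_eq_inner_L2[OF k] by (simp add: w_def)
  have "AE t in lebesgue_on {0..}. has_L2_derivative d x (\<lambda>i k. - graph_laplacian a t (x t) i k) t
      \<and> regular_kernel (a t) \<and> balanced (a t)"
    using deriv good by eventually_elim simp
  then obtain N where N: "negligible N" "\<And>t. t \<in> {0..} - N \<Longrightarrow>
      has_L2_derivative d x (\<lambda>i k. - graph_laplacian a t (x t) i k) t
      \<and> regular_kernel (a t) \<and> balanced (a t)"
    by (rule AE_lebesgue_on_negligibleE) auto
  have D: "((\<lambda>s. mean (x s) k) has_real_derivative 0) (at s within {0..t})" if s: "s \<in> {0..t} - N" for s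
  proof -
    have s0: "s \<in> {0..} - N" "s \<ge> 0" using s by auto
    have "mean (graph_laplacian a s (x s)) k = 0"
      using laplacian_balanced(1)[where a = a and t = s, OF _ _ L2[OF s0(2)] k] N(2)[OF s0(1)] by blast
    then have "mean (\<lambda>i k. - graph_laplacian a s (x s) i k) k = 0"
      by (simp add: mean_def)
    moreover have "((\<lambda>s. mean (x s) k) has_real_derivative mean (\<lambda>i k. - graph_laplacian a s (x s) i k) k) (at s within {0..})"
      unfolding mean_w using N(2)[OF s0(1)] s0 by (intro inner_L2_has_derivative L2 w) auto
    ultimately show ?thesis by (auto intro: DERIV_subset)
  qed
  obtain L where L: "L-lipschitz_on {0..t} (\<lambda>s. mean (x s) k)"
  proof (rule Lip_loc_L2_imp_lipschitz[OF lip norm_L2_nonneg[of d w]])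
    fix r s :: real assume rs: "r \<ge> 0" "s \<ge> 0"
    have "mean (x s) k - mean (x r) k = inner_L2 d (\<lambda>i k. x s i k - x r i k) w"
      unfolding mean_w using inner_L2_add_scale[OF L2[OF rs(2)] L2[OF rs(1)] w, of "-1"] by simp
    then show "\<bar>mean (x s) k - mean (x r) k\<bar> \<le> norm_L2 d w * norm_L2 d (\<lambda>i k. x s i k - x r i k)"
      using inner_L2_Cauchy_Schwarz[OF L2_diff[OF L2[OF rs(2)] L2[OF rs(1)]] w]
      by (simp add: mult.commute)
  qed blast
  have "mean (x t) k - mean (x 0) k \<le> integral {0..t} (\<lambda>_. 0)"
  proof (rule lipschitz_diff_le_integral[OF t L N(1)])
    show "\<exists>D\<le>0. ((\<lambda>s. mean (x s) k) has_real_derivative D) (at s within {0..t})"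
      if "s \<in> {0..t} - N" for s
      using D[OF that] by auto
  qed (rule integrable_0)
  \<comment> \<open>The comparison is one-sided, so it is applied to the negative as well.\<close>
  moreover have "- mean (x t) k - - mean (x 0) k \<le> integral {0..t} (\<lambda>_. 0)"
  proof (rule lipschitz_diff_le_integral[OF t _ N(1)])
    show "L-lipschitz_on {0..t} (\<lambda>s. - mean (x s) k)" using L by simp
    show "\<exists>D\<le>0. ((\<lambda>s. - mean (x s) k) has_real_derivative D) (at s within {0..t})"
      if "s \<in> {0..t} - N" for s
      using DERIV_minus[OF D[OF that]] by auto
  qed (rule integrable_0)
  moreover have "mean (x 0) k = mean x0 k"
    unfolding mean_def
  proof (rule integral_lebesgue_on_cong_AE[symmetric])
    show "AE i in unit_int. x 0 i k = x0 i k"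
      using init k unfolding eq_L2_def by (auto elim: eventually_mono)
  qed (use L2D(1)[OF L2 k, of 0] in auto)
  ultimately show ?thesis by simp
qed

section \<open>Exponential decay of the distance to the mean\<close>

theorem theorem4p11:
  fixes \<tau> \<mu> :: real
  assumes "\<tau> > 0" and "0 < \<mu>" and "\<mu> \<le> 1"
  shows "\<exists>\<alpha>>0. \<forall>d::nat. \<forall>a :: real \<Rightarrow> real \<Rightarrow> real \<Rightarrow> real.
    \<forall>x0 :: real \<Rightarrow> nat \<Rightarrow> real. \<forall>x :: real \<Rightarrow> real \<Rightarrow> nat \<Rightarrow> real.
      d \<ge> 1 \<longrightarrow>
      x0 \<in> L2 d \<longrightarrow>
      (\<forall>t\<ge>0. \<forall>i\<in>{0..1}. \<forall>j\<in>{0..1}. a t i j \<in> {0..1}) \<longrightarrow>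
      (\<lambda>(t, i, j). a t i j) \<in> borel_measurable (lebesgue_on ({0..} \<times> {0..1} \<times> {0..1})) \<longrightarrow>
      (AE t in lebesgue_on {0..}. balanced (a t)) \<longrightarrow>
      (\<forall>t\<ge>0. (1 / \<tau>) * (LINT s:{t..t+\<tau>}|lebesgue. lambda2 d (graph_laplacian a s)) \<ge> \<mu>) \<longrightarrow>
      is_solution d a x0 x \<longrightarrow>
      (\<forall>t\<ge>0. norm_L2 d (\<lambda>i k. x t i k - mean x0 k)
               \<le> \<alpha> * norm_L2 d (\<lambda>i k. x 0 i k - mean x0 k) * exp (- \<mu> * t))"
proof (intro exI[of _ "exp (\<mu> * \<tau>)"] conjI allI impI)
  fix d :: nat and a x0 x and t :: real
  assume range: "\<forall>t\<ge>0. \<forall>i\<in>{0..1}. \<forall>j\<in>{0..1}. a t i j \<in> {0..1}"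
    and meas: "(\<lambda>(t, i, j). a t i j) \<in> borel_measurable (lebesgue_on ({0..} \<times> {0..1} \<times> {0..1}))"
    and bal: "AE t in lebesgue_on {0..}. balanced (a t)"
    and conn: "\<forall>t\<ge>0. (1 / \<tau>) * (LINT s:{t..t+\<tau>}|lebesgue. lambda2 d (graph_laplacian a s)) \<ge> \<mu>"
    and sol: "is_solution d a x0 x" and t: "t \<ge> 0"
  define l where "l s = lambda2 d (graph_laplacian a s)" for s
  define y where "y s = (\<lambda>i k. x s i k - mean x0 k)" for s
  define E where "E s = (norm_L2 d (y s))\<^sup>2" for s
  have lip: "Lip_loc_L2 d x"
    and deriv: "AE t in lebesgue_on {0..}. has_L2_derivative d x (\<lambda>i k. - graph_laplacian a t (x t) i k) t"
    using sol by (auto simp: is_solution_def)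
  have xL2: "x s \<in> L2 d" if "s \<ge> 0" for s using lip that by (simp add: Lip_loc_L2_def)
  have yL2: "y s \<in> L2 d" if "s \<ge> 0" for s
    unfolding y_def using L2_diff[OF xL2[OF that] L2_const] .
  have good: "AE t in lebesgue_on {0..}. regular_kernel (a t) \<and> balanced (a t)"
    using AE_regular_kernel_section[OF _ meas] range bal by (auto elim: eventually_elim2)
  have ymean: "mean (y s) k = 0" if "s \<ge> 0" "k < d" for s k
    using mean_diff_const[OF xL2 that(2), of s "mean x0"] solution_mean[OF sol that good] that
    by (simp add: y_def)
  have "AE t in lebesgue_on {0..}. has_L2_derivative d x (\<lambda>i k. - graph_laplacian a t (x t) i k) t
      \<and> regular_kernel (a t) \<and> balanced (a t)"
    using deriv good by eventually_elim simp
  then obtain N where N: "negligible N" "\<And>t. t \<in> {0..} - N \<Longrightarrow>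
      has_L2_derivative d x (\<lambda>i k. - graph_laplacian a t (x t) i k) t
      \<and> regular_kernel (a t) \<and> balanced (a t)"
    by (rule AE_lebesgue_on_negligibleE) auto
  \<comment> \<open>The bound 0 yields monotonicity without any integrability of \<open>l\<close>;
    the bound through \<open>l\<close> yields the decay rate.\<close>
  have E': "\<exists>D. (E has_real_derivative D) (at s within {0..}) \<and> D \<le> 0 \<and> D \<le> - (2 * l s * E s)"
    if s: "s \<in> {0..} - N" for s
  proof -
    have s0: "s \<ge> 0" using s by simp
    have reg: "regular_kernel (a s)" "balanced (a s)" using N(2)[OF s] by auto
    let ?v = "\<lambda>i k. - graph_laplacian a s (x s) i k"
    have "has_L2_derivative d y ?v s"
      using N(2)[OF s] by (simp add: has_L2_derivative_def y_def)
    then have "(E has_real_derivative 2 * inner_L2 d ?v (y s)) (at s within {0..})"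
      unfolding E_def using yL2 s0 by (intro norm_L2_power2_has_derivative)
    \<comment> \<open>The Laplacian sees only differences of values, so the constant subtracted in
      \<open>y s\<close> drops out.\<close>
    moreover have "inner_L2 d ?v (y s) = - inner_L2 d (graph_laplacian a s (y s)) (y s)"
      by (simp add: inner_L2_def graph_laplacian_def y_def sum_negf)
    moreover have "0 \<le> inner_L2 d (graph_laplacian a s (y s)) (y s)"
      by (rule laplacian_balanced(2)[where a = a and t = s, OF reg yL2[OF s0]])
    moreover have "l s * E s \<le> inner_L2 d (graph_laplacian a s (y s)) (y s)"
      unfolding l_def E_def using reg yL2[OF s0] ymean[OF s0] by (rule lambda2_le)
    ultimately show ?thesis by (intro exI[of _ "2 * inner_L2 d ?v (y s)"]) simp
  qed
  have E_lip: "\<exists>L. L-lipschitz_on {r..s} E" if r: "r \<ge> 0" for r s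
  proof -
    obtain L where L: "L-lipschitz_on {0..s} (\<lambda>u. norm_L2 d (y u))"
    proof (rule Lip_loc_L2_imp_lipschitz[OF lip zero_le_one])
      fix r s :: real assume rs: "r \<ge> 0" "s \<ge> 0"
      show "\<bar>norm_L2 d (y s) - norm_L2 d (y r)\<bar> \<le> 1 * norm_L2 d (\<lambda>i k. x s i k - x r i k)"
        using norm_L2_diff_ge[OF yL2[OF rs(2)] yL2[OF rs(1)]] by (simp add: y_def)
    qed blast
    \<comment> \<open>A bound of the norm on \<open>{0..s}\<close>. Its absolute value keeps the
      Lipschitz constant of \<open>E\<close> nonnegative also for negative \<open>s\<close>, when
      the interval is empty.\<close>
    define M where "M = norm_L2 d (y 0) + L * s"
    have M: "norm_L2 d (y u) \<le> \<bar>M\<bar>" if u: "u \<in> {0..s}" for u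
    proof -
      have "norm_L2 d (y u) \<le> norm_L2 d (y 0) + L * u"
        using lipschitz_onD[OF L u, of 0] u by (simp add: dist_real_def)
      also have "\<dots> \<le> \<bar>M\<bar>"
        using mult_left_mono[of u s L] u lipschitz_on_nonneg[OF L] by (simp add: M_def)
      finally show ?thesis .
    qed
    have "(L * (2 * \<bar>M\<bar>))-lipschitz_on {0..s} E"
    proof (rule lipschitz_onI)
      fix u v assume uv: "u \<in> {0..s}" "v \<in> {0..s}"
      have "dist (E u) (E v) = \<bar>norm_L2 d (y u) - norm_L2 d (y v)\<bar> * \<bar>norm_L2 d (y u) + norm_L2 d (y v)\<bar>"
        unfolding dist_real_def E_def abs_mult[symmetric] by (simp add: power2_eq_square algebra_simps)
      also have "\<dots> \<le> (L * dist u v) * (2 * \<bar>M\<bar>)"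
        using lipschitz_onD[OF L uv] M[OF uv(1)] M[OF uv(2)] lipschitz_on_nonneg[OF L]
          norm_L2_nonneg[of d "y u"] norm_L2_nonneg[of d "y v"]
        by (intro mult_mono) (auto simp: dist_real_def)
      finally show "dist (E u) (E v) \<le> L * (2 * \<bar>M\<bar>) * dist u v" by (simp add: ac_simps)
    qed (use lipschitz_on_nonneg[OF L] in simp)
    then have "(L * (2 * \<bar>M\<bar>))-lipschitz_on {r..s} E"
      by (rule lipschitz_on_subset) (use r in auto)
    then show ?thesis ..
  qed
  have E_within: "(E has_real_derivative D) (at u within {r..s})"
    if "(E has_real_derivative D) (at u within {0..})" "r \<ge> 0" for D u r s
    using that by (auto intro: DERIV_subset)
  have E_decr: "E s \<le> E r" if rs: "0 \<le> r" "r \<le> s" for r s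
  proof -
    obtain L where L: "L-lipschitz_on {r..s} E" using E_lip[OF rs(1)] by blast
    have "E s - E r \<le> integral {r..s} (\<lambda>_. 0)"
    proof (rule lipschitz_diff_le_integral[OF rs(2) L N(1)])
      show "\<exists>D\<le>0. (E has_real_derivative D) (at u within {r..s})" if "u \<in> {r..s} - N" for u
        using E'[of u] E_within[OF _ rs(1)] that rs by fastforce
    qed (rule integrable_0)
    then show ?thesis by simp
  qed
  have E_step: "E (r + \<tau>) \<le> E r * exp (- (2 * \<mu> * \<tau>))" if r: "r \<ge> 0" for r
  \<comment> \<open>If \<open>E\<close> vanishes at the right endpoint, the claim is trivial.
    Otherwise monotonicity makes this value a positive lower bound on the whole interval, so
    \<open>ln E\<close> is Lipschitz there.\<close>
  proof (cases "E (r + \<tau>) = 0")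
    case True
    then show ?thesis by (simp add: E_def)
  next
    case False
    then have c: "E (r + \<tau>) > 0" by (simp add: E_def)
    have ge: "E u \<ge> E (r + \<tau>)" if "u \<in> {r..r+\<tau>}" for u
      using that r by (intro E_decr) auto
    have \<mu>: "\<mu> * \<tau> \<le> (LINT s:{r..r+\<tau>}|lebesgue. l s)"
      using conn r assms(1) by (simp add: l_def pos_le_divide_eq)
    \<comment> \<open>A non-integrable function would have integral \<open>0\<close>, against the connectivity assumption.\<close>
    have int: "set_integrable lebesgue {r..r+\<tau>} l"
    proof (rule ccontr)
      assume "\<not> set_integrable lebesgue {r..r+\<tau>} l"
      then have "(LINT s:{r..r+\<tau>}|lebesgue. l s) = 0"
        unfolding set_integrable_def set_lebesgue_integral_def by (rule not_integrable_integral_eq)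
      then show False using \<mu> mult_pos_pos[OF assms(2,1)] by simp
    qed
    \<comment> \<open>The connectivity assumption is a Lebesgue integral, the comparison lemma a
      gauge integral; they agree for integrable functions.\<close>
    have intl: "l integrable_on {r..r+\<tau>}" "(LINT s:{r..r+\<tau>}|lebesgue. l s) = integral {r..r+\<tau>} l"
      using set_lebesgue_integral_eq_integral[OF int] by auto
    obtain L where L: "L-lipschitz_on {r..r+\<tau>} E" using E_lip[OF r] by blast
    have "ln (E (r + \<tau>)) - ln (E r) \<le> integral {r..r+\<tau>} (\<lambda>u. - 2 * l u)"
    proof (rule lipschitz_diff_le_integral[OF _ lipschitz_on_ln[OF L c ge] N(1)])
      show "r \<le> r + \<tau>" using assms(1) by simp
      show "(\<lambda>u. - 2 * l u) integrable_on {r..r+\<tau>}"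
        using intl(1) by (rule integrable_on_mult_right)
      fix u assume u: "u \<in> {r..r+\<tau>} - N"
      then obtain D where D: "(E has_real_derivative D) (at u within {r..r+\<tau>})" "D \<le> - (2 * l u * E u)"
        using E'[of u] E_within[OF _ r] r by fastforce
      have pos: "E u > 0" using ge[of u] c u by auto
      have "((\<lambda>u. ln (E u)) has_real_derivative D / E u) (at u within {r..r+\<tau>})"
        using D(1) pos by (auto intro!: derivative_eq_intros)
      moreover have "D / E u \<le> - 2 * l u" using D(2) pos by (simp add: pos_divide_le_eq)
      ultimately show "\<exists>D\<le>- 2 * l u. ((\<lambda>u. ln (E u)) has_real_derivative D) (at u within {r..r+\<tau>})"
        by blast
    qed auto
    also have "\<dots> = - 2 * integral {r..r+\<tau>} l" by simp
    also have "\<dots> \<le> - (2 * \<mu> * \<tau>)" using \<mu> intl(2) by simp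
    finally have "ln (E (r + \<tau>)) \<le> ln (E r) + - (2 * \<mu> * \<tau>)" by simp
    then have "exp (ln (E (r + \<tau>))) \<le> exp (ln (E r) + - (2 * \<mu> * \<tau>))" by (simp only: exp_le_cancel_iff)
    moreover have "E r > 0" using ge[of r] c assms(1) by simp
    ultimately show ?thesis using c by (simp only: exp_add exp_ln)
  qed
  have E_iter: "E (real n * \<tau>) \<le> E 0 * exp (- (2 * \<mu> * \<tau>)) ^ n" for n
  proof (induction n)
    case (Suc n)
    have "E (real (Suc n) * \<tau>) = E (real n * \<tau> + \<tau>)" by (simp add: algebra_simps)
    also have "\<dots> \<le> E (real n * \<tau>) * exp (- (2 * \<mu> * \<tau>))"
      using assms(1) by (intro E_step) simp
    also have "\<dots> \<le> (E 0 * exp (- (2 * \<mu> * \<tau>)) ^ n) * exp (- (2 * \<mu> * \<tau>))"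
      using Suc by (intro mult_right_mono) auto
    finally show ?case by (simp add: mult.commute mult.left_commute)
  qed simp
  \<comment> \<open>The number of complete intervals of length \<tau> up to time \<open>t\<close>;
    monotonicity covers the rest.\<close>
  define n where "n = nat \<lfloor>t / \<tau>\<rfloor>"
  have n_le: "real n * \<tau> \<le> t" and n_ge: "t - \<tau> \<le> real n * \<tau>"
  proof -
    have "real n = of_int \<lfloor>t / \<tau>\<rfloor>" using t assms(1) by (simp add: n_def)
    then have "real n \<le> t / \<tau>" "t / \<tau> - 1 \<le> real n" by linarith+
    then show "real n * \<tau> \<le> t" "t - \<tau> \<le> real n * \<tau>"
      using assms(1) by (simp_all add: field_simps)
  qed
  have "E t \<le> E (real n * \<tau>)" using n_le assms(1) by (intro E_decr) auto
  also note E_iter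
  also have "E 0 * exp (- (2 * \<mu> * \<tau>)) ^ n = E 0 * exp (- (2 * \<mu>) * (real n * \<tau>))"
    by (subst exp_of_nat_mult[symmetric]) (simp add: mult.commute mult.left_commute)
  \<comment> \<open>Replacing \<open>real n * \<tau>\<close> by the smaller
    \<open>t - \<tau>\<close> leaves a factor \<open>exp (2 * \<mu> * \<tau>)\<close> for the
    squared norm, hence \<open>exp (\<mu> * \<tau>)\<close> for the norm.\<close>
  also have "\<dots> \<le> E 0 * exp (- (2 * \<mu>) * (t - \<tau>))"
    using n_ge assms(2) by (intro mult_left_mono) (auto simp: E_def)
  also have "\<dots> = (exp (\<mu> * \<tau>) * norm_L2 d (y 0) * exp (- \<mu> * t))\<^sup>2"
  proof -
    have "exp (- (2 * \<mu>) * (t - \<tau>)) = (exp (\<mu> * \<tau>))\<^sup>2 * (exp (- \<mu> * t))\<^sup>2"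
      unfolding exp_double[symmetric] exp_add[symmetric] by (simp add: algebra_simps)
    then show ?thesis by (simp add: E_def power_mult_distrib)
  qed
  finally have "(norm_L2 d (y t))\<^sup>2 \<le> (exp (\<mu> * \<tau>) * norm_L2 d (y 0) * exp (- \<mu> * t))\<^sup>2"
    by (simp only: E_def)
  then show "norm_L2 d (\<lambda>i k. x t i k - mean x0 k)
      \<le> exp (\<mu> * \<tau>) * norm_L2 d (\<lambda>i k. x 0 i k - mean x0 k) * exp (- \<mu> * t)"
    unfolding y_def by (rule power2_le_imp_le) (simp add: norm_L2_nonneg)
qed simp

end
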